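(* $(H^\infty_{\mathrm{sym}}(\mathbb{B}_n),\|\cdot\|_{\mathrm{sym}})$ is a Banach space.
   Context: $\mathbb{B}_n$ is the open unit ball of $\mathbb{C}^n$. $\mathbb{F}_n^+$ is the unital free semigroup on generators $g_1,\ldots,g_n$ with identity $g_0$; for $\alpha=g_{i_1}\cdots g_{i_k}$, $|\alpha|=k$, $S_\alpha:=S_{i_1}\cdots S_{i_k}$, $\lambda_\alpha:=\lambda_{i_1}\cdots\lambda_{i_k}$ (and $S_{g_0}:=I$, $\lambda_{g_0}:=1$). $S_1,\ldots,S_n$ are the left creation operators $S_i\xi:=e_i\otimes\xi$ on the full Fock space $F^2(H_n)=\mathbb{C}1\oplus\bigoplus_{m\ge1}H_n^{\otimes m}$, $H_n$ an $n$-dimensional Hilbert space with orthonormal basis $e_1,\ldots,e_n$. For $\mathbf{p}=(p_1,\ldots,p_n)\in\mathbb{Z}_+^n$, put $|\mathbf{p}|:=p_1+\cdots+p_n$, $\mathbf{p}!:=p_1!\cdots p_n!$, $\lambda^{\mathbf{p}}:=\lambda_1^{p_1}\cdots\lambda_n^{p_n}$, and $\Lambda_{\mathbf{p}}:=\{\alpha\in\mathbb{F}_n^+:\lambda_\alpha=\lambda^{\mathbf{p}}\text{ for any }\lambda\in\mathbb{B}_n\}$, which has $|\mathbf{p}|!/\mathbf{p}!$ elements. $H_{\mathrm{sym}}(\mathbb{B}_n)$ is the set of all analytic functions $f(\lambda)=\sum_{\mathbf{p}\in\mathbb{Z}_+^n}a_{\mathbf{p}}\lambda^{\mathbf{p}}$,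 $a_{\mathbf{p}}\in\mathbb{C}$, on $\mathbb{B}_n$ such that $$\limsup_{k\to\infty}\Big(\sum_{|\mathbf{p}|=k}\frac{\mathbf{p}!}{|\mathbf{p}|!}|a_{\mathbf{p}}|^2\Big)^{1/2k}\le1.$$ For such $f$ and $0\le r<1$, the symmetrized functional calculus is $$f_{\mathrm{sym}}(rS_1,\ldots,rS_n):=\sum_{k=0}^\infty\sum_{|\mathbf{p}|=k}r^ka_{\mathbf{p}}\frac{\mathbf{p}!}{|\mathbf{p}|!}\sum_{\alpha\in\Lambda_{\mathbf{p}}}S_\alpha,$$ which is norm convergent in $k$. $H^\infty_{\mathrm{sym}}(\mathbb{B}_n)$ is the set of $f\in H_{\mathrm{sym}}(\mathbb{B}_n)$ with $\|f\|_{\mathrm{sym}}:=\sup_{0\le r<1}\|f_{\mathrm{sym}}(rS_1,\ldots,rS_n)\|<\infty$. *)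

theory Defs
  imports "HOL-Analysis.Analysis" "HOL-Library.Function_Algebras"
begin

section \<open>The full Fock space\<close>

text \<open>
  The \<open>n\<close>-dimensional Hilbert space is \<open>complex ^ 'n\<close> with \<open>n = CARD('n)\<close> and orthonormal basis
  \<open>axis i 1\<close>.  The free semigroup on \<open>n\<close> generators is \<open>'n list\<close> under concatenation, with
  identity \<open>[]\<close>.  A tensor of degree \<open>m\<close> is given by its array of coordinates, a complex
  function on the words of length \<open>m\<close>, so that the Hilbert direct sum over all \<open>m\<close> consists of the
  square-summable functions on all words; \<open>[]\<close> is the coordinate of the vacuum vector.
\<close>

typedef 'n fock = "{x :: 'n list \<Rightarrow> complex. (\<lambda>w. (cmod (x w))\<^sup>2) summable_on UNIV}"
  morphisms fock_coord Abs_fock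
  by (rule exI[of _ "\<lambda>_. 0"]) simp

setup_lifting type_definition_fock

lemma sq_summable_iff:
  fixes x :: "'a \<Rightarrow> complex"
  shows "(\<lambda>w. (cmod (x w))\<^sup>2) summable_on UNIV \<longleftrightarrow>
         (\<exists>B. \<forall>F. finite F \<longrightarrow> L2_set (\<lambda>w. cmod (x w)) F \<le> B)"
proof
  assume s: "(\<lambda>w. (cmod (x w))\<^sup>2) summable_on UNIV"
  have "L2_set (\<lambda>w. cmod (x w)) F \<le> sqrt (infsum (\<lambda>w. (cmod (x w))\<^sup>2) UNIV)" if "finite F" for F
    unfolding L2_set_def using finite_sum_le_infsum[OF s that] by simp
  then show "\<exists>B. \<forall>F. finite F \<longrightarrow> L2_set (\<lambda>w. cmod (x w)) F \<le> B" by blast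
next
  assume "\<exists>B. \<forall>F. finite F \<longrightarrow> L2_set (\<lambda>w. cmod (x w)) F \<le> B"
  then obtain B where B: "\<And>F. finite F \<Longrightarrow> L2_set (\<lambda>w. cmod (x w)) F \<le> B" by blast
  have "(\<Sum>w\<in>F. (cmod (x w))\<^sup>2) \<le> B\<^sup>2" if "finite F" for F
    using B[OF that] unfolding L2_set_def by (rule sqrt_le_D)
  then show "(\<lambda>w. (cmod (x w))\<^sup>2) summable_on UNIV"
    by (intro nonneg_bdd_above_summable_on) (auto intro!: bdd_aboveI[of _ "B\<^sup>2"])
qed

lemma L2_set_add_le:
  fixes x y :: "'a \<Rightarrow> complex"
  shows "L2_set (\<lambda>w. cmod (x w + y w)) F \<le> L2_set (\<lambda>w. cmod (x w)) F + L2_set (\<lambda>w. cmod (y w)) F"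
  by (rule order_trans[OF L2_set_mono L2_set_triangle_ineq]) (auto intro: norm_triangle_ineq)

lemma L2_set_cmult:
  fixes x :: "'a \<Rightarrow> complex"
  shows "L2_set (\<lambda>w. cmod (c * x w)) F = cmod c * L2_set (\<lambda>w. cmod (x w)) F"
  by (simp add: L2_set_right_distrib norm_mult)

lemma sq_summable_add:
  fixes x y :: "'a \<Rightarrow> complex"
  assumes "(\<lambda>w. (cmod (x w))\<^sup>2) summable_on UNIV" "(\<lambda>w. (cmod (y w))\<^sup>2) summable_on UNIV"
  shows "(\<lambda>w. (cmod (x w + y w))\<^sup>2) summable_on UNIV"
proof -
  obtain A B where "\<And>F. finite F \<Longrightarrow> L2_set (\<lambda>w. cmod (x w)) F \<le> A"
    "\<And>F. finite F \<Longrightarrow> L2_set (\<lambda>w. cmod (y w)) F \<le> B"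
    using assms unfolding sq_summable_iff by blast
  then have "L2_set (\<lambda>w. cmod (x w + y w)) F \<le> A + B" if "finite F" for F
    using L2_set_add_le[of x y F] that by (smt (verit))
  then show ?thesis unfolding sq_summable_iff by blast
qed

lemma sq_summable_cmult:
  fixes x :: "'a \<Rightarrow> complex"
  assumes "(\<lambda>w. (cmod (x w))\<^sup>2) summable_on UNIV"
  shows "(\<lambda>w. (cmod (c * x w))\<^sup>2) summable_on UNIV"
  using summable_on_cmult_right[OF assms, of "(cmod c)\<^sup>2"]
  by (simp add: norm_mult power_mult_distrib)

instantiation fock :: (type) real_normed_vector
begin

lift_definition zero_fock :: "'a fock" is "\<lambda>_. 0" by simp

lift_definition plus_fock :: "'a fock \<Rightarrow> 'a fock \<Rightarrow> 'a fock" is "\<lambda>x y w. x w + y w"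
  by (rule sq_summable_add)

lift_definition uminus_fock :: "'a fock \<Rightarrow> 'a fock" is "\<lambda>x w. - x w" by simp

lift_definition minus_fock :: "'a fock \<Rightarrow> 'a fock \<Rightarrow> 'a fock" is "\<lambda>x y w. x w - y w"
  subgoal for x y using sq_summable_add[of x "\<lambda>w. - y w"] by simp
  done

lift_definition scaleR_fock :: "real \<Rightarrow> 'a fock \<Rightarrow> 'a fock" is "\<lambda>r x w. complex_of_real r * x w"
  by (rule sq_summable_cmult)

lift_definition norm_fock :: "'a fock \<Rightarrow> real" is "\<lambda>x. sqrt (\<Sum>\<^sub>\<infinity>w. (cmod (x w))\<^sup>2)" .

definition "dist_fock (x :: 'a fock) y = norm (x - y)"
definition "sgn_fock (x :: 'a fock) = scaleR (inverse (norm x)) x"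
definition [code del]:
  "(uniformity :: ('a fock \<times> 'a fock) filter) = (INF e\<in>{0 <..}. principal {(x, y). dist x y < e})"
definition [code del]:
  "open (U :: 'a fock set) \<longleftrightarrow> (\<forall>x\<in>U. eventually (\<lambda>(x', y). x' = x \<longrightarrow> y \<in> U) uniformity)"

lemma L2_set_le_norm_fock: "finite F \<Longrightarrow> L2_set (\<lambda>w. cmod (fock_coord x w)) F \<le> norm (x :: 'a fock)"
proof transfer
  fix F :: "'a list set" and x :: "'a list \<Rightarrow> complex"
  assume "finite F" "(\<lambda>w. (cmod (x w))\<^sup>2) summable_on UNIV"
  then show "L2_set (\<lambda>w. cmod (x w)) F \<le> sqrt (\<Sum>\<^sub>\<infinity>w. (cmod (x w))\<^sup>2)"
    unfolding L2_set_def using finite_sum_le_infsum[of "\<lambda>w. (cmod (x w))\<^sup>2" UNIV F] by simp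
qed

lemma norm_fock_leI:
  "(\<And>F. finite F \<Longrightarrow> L2_set (\<lambda>w. cmod (fock_coord x w)) F \<le> B) \<Longrightarrow> norm (x :: 'a fock) \<le> B"
proof transfer
  fix B and x :: "'a list \<Rightarrow> complex"
  assume s: "(\<lambda>w. (cmod (x w))\<^sup>2) summable_on UNIV"
    and B: "\<And>F. finite F \<Longrightarrow> L2_set (\<lambda>w. cmod (x w)) F \<le> B"
  have "B \<ge> 0" using B[of "{}"] by simp
  moreover have "(\<Sum>\<^sub>\<infinity>w. (cmod (x w))\<^sup>2) \<le> B\<^sup>2"
    using B by (intro infsum_le_finite_sums[OF s]) (auto simp: L2_set_def intro: sqrt_le_D)
  ultimately show "sqrt (\<Sum>\<^sub>\<infinity>w. (cmod (x w))\<^sup>2) \<le> B"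
    using real_le_lsqrt by blast
qed

lemma cmod_coord_le_norm_fock: "cmod (fock_coord x w) \<le> norm (x :: 'a fock)"
  using L2_set_le_norm_fock[of "{w}" x] by simp

instance
proof
  fix x y z :: "'a fock" and a b :: real and U :: "'a fock set"
  show "x + y + z = x + (y + z)" by transfer (simp add: add.assoc)
  show "x + y = y + x" by transfer (simp add: add.commute)
  show "0 + x = x" by transfer simp
  show "- x + x = 0" by transfer simp
  show "x - y = x + - y" by transfer simp
  show "a *\<^sub>R (x + y) = a *\<^sub>R x + a *\<^sub>R y" by transfer (simp add: algebra_simps)
  show "(a + b) *\<^sub>R x = a *\<^sub>R x + b *\<^sub>R x" by transfer (simp add: algebra_simps)
  show "a *\<^sub>R b *\<^sub>R x = (a * b) *\<^sub>R x" by transfer (simp add: algebra_simps)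
  show "1 *\<^sub>R x = x" by transfer simp
  show "(norm x = 0) = (x = 0)"
  proof
    assume "norm x = 0"
    then have "fock_coord x w = 0" for w using cmod_coord_le_norm_fock[of x w] by simp
    then show "x = 0" by transfer auto
  next
    assume "x = 0" then show "norm x = 0" by transfer simp
  qed
  show "norm (x + y) \<le> norm x + norm y"
  proof (rule norm_fock_leI)
    fix F :: "'a list set" assume "finite F"
    then show "L2_set (\<lambda>w. cmod (fock_coord (x + y) w)) F \<le> norm x + norm y"
      using L2_set_add_le[of "fock_coord x" "fock_coord y" F]
        L2_set_le_norm_fock[of F x] L2_set_le_norm_fock[of F y]
      by (simp add: plus_fock.rep_eq)
  qed
  show "norm (a *\<^sub>R x) = \<bar>a\<bar> * norm x"
    by transfer (simp add: norm_mult power_mult_distrib infsum_cmult_right' real_sqrt_mult)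
qed (simp_all add: dist_fock_def sgn_fock_def uniformity_fock_def open_fock_def)

end

instance fock :: (type) banach
proof
  fix X :: "nat \<Rightarrow> 'a fock"
  assume C: "Cauchy X"
  have "Cauchy (\<lambda>k. fock_coord (X k) w)" for w
  proof (rule metric_CauchyI)
    fix e :: real assume "e > 0"
    then obtain M where "\<forall>m\<ge>M. \<forall>k\<ge>M. dist (X m) (X k) < e" using C metric_CauchyD by blast
    moreover have "dist (fock_coord (X m) w) (fock_coord (X k) w) \<le> dist (X m) (X k)" for m k
      using cmod_coord_le_norm_fock[of "X m - X k" w] by (simp add: dist_norm minus_fock.rep_eq)
    ultimately show "\<exists>M. \<forall>m\<ge>M. \<forall>k\<ge>M. dist (fock_coord (X m) w) (fock_coord (X k) w) < e"
      by (meson le_less_trans)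
  qed
  then have "\<forall>w. \<exists>l. (\<lambda>k. fock_coord (X k) w) \<longlonglongrightarrow> l"
    by (simp add: Cauchy_convergent_iff convergent_def)
  then obtain l where l: "\<And>w. (\<lambda>k. fock_coord (X k) w) \<longlonglongrightarrow> l w" by metis
  have bound: "L2_set (\<lambda>w. cmod (l w - fock_coord y w)) F \<le> B"
    if "finite F" and "\<forall>k\<ge>N. norm (X k - y) \<le> B" for F y B N
  proof (rule LIMSEQ_le_const2)
    show "(\<lambda>k. L2_set (\<lambda>w. cmod (fock_coord (X k) w - fock_coord y w)) F)
            \<longlonglongrightarrow> L2_set (\<lambda>w. cmod (l w - fock_coord y w)) F"
      unfolding L2_set_def by (intro tendsto_intros l)
    show "\<exists>N. \<forall>k\<ge>N. L2_set (\<lambda>w. cmod (fock_coord (X k) w - fock_coord y w)) F \<le> B"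
    proof (intro exI allI impI)
      fix k assume "k \<ge> N"
      then show "L2_set (\<lambda>w. cmod (fock_coord (X k) w - fock_coord y w)) F \<le> B"
        using that L2_set_le_norm_fock[OF \<open>finite F\<close>, of "X k - y"]
        by (force simp: minus_fock.rep_eq)
    qed
  qed
  obtain K where K: "\<And>k. norm (X k) \<le> K"
    using Cauchy_Bseq[OF C] by (auto simp: Bseq_def)
  have "(\<lambda>w. (cmod (l w))\<^sup>2) summable_on UNIV"
    unfolding sq_summable_iff using bound[of _ 0 0 K] K by (auto simp: zero_fock.rep_eq)
  then obtain L where L: "fock_coord L = l" by (metis Abs_fock_inverse mem_Collect_eq)
  have "X \<longlonglongrightarrow> L"
  proof (rule metric_LIMSEQ_I)
    fix e :: real assume "e > 0"
    then obtain M where M: "\<forall>m\<ge>M. \<forall>k\<ge>M. dist (X m) (X k) < e / 2"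
      using C metric_CauchyD half_gt_zero by blast
    have "norm (L - X m) \<le> e / 2" if "m \<ge> M" for m
    proof (rule norm_fock_leI)
      fix F :: "'a list set" assume "finite F"
      have "\<forall>k\<ge>M. norm (X k - X m) \<le> e / 2"
        using M that by (auto simp: dist_norm less_imp_le)
      from bound[OF \<open>finite F\<close> this]
      show "L2_set (\<lambda>w. cmod (fock_coord (L - X m) w)) F \<le> e / 2"
        by (simp add: minus_fock.rep_eq L)
    qed
    then show "\<exists>M. \<forall>m\<ge>M. dist (X m) L < e"
      using \<open>e > 0\<close> by (intro exI[of _ M]) (fastforce simp: dist_norm norm_minus_commute)
  qed
  then show "convergent X" by (auto simp: convergent_def)
qed

text \<open>
  Bounded operators on the Fock space are elements of \<open>'n fock \<Rightarrow>\<^sub>L 'n fock\<close>, whose norm is the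
  operator norm.  Elements of that type are only required to be real-linear; multiplication of an
  operator by a complex scalar \<open>c\<close> is composition with \<open>fock_scale c\<close>.
\<close>

lift_definition fock_scaleC :: "complex \<Rightarrow> 'n fock \<Rightarrow> 'n fock" is "\<lambda>c x w. c * x w"
  by (rule sq_summable_cmult)

lemma norm_fock_scaleC: "norm (fock_scaleC c x) = cmod c * norm x"
  by transfer (simp add: norm_mult power_mult_distrib infsum_cmult_right' real_sqrt_mult)

lift_definition fock_scale :: "complex \<Rightarrow> 'n fock \<Rightarrow>\<^sub>L 'n fock" is fock_scaleC
proof -
  fix c
  show "bounded_linear (fock_scaleC c :: 'n fock \<Rightarrow> 'n fock)"
  proof (rule bounded_linear_intro)
    show "fock_scaleC c (x + y) = fock_scaleC c x + fock_scaleC c y" for x y :: "'n fock"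
      by transfer (auto simp: algebra_simps)
    show "fock_scaleC c (r *\<^sub>R x) = r *\<^sub>R fock_scaleC c x" for r and x :: "'n fock"
      by transfer (auto simp: algebra_simps)
    show "norm (fock_scaleC c x) \<le> norm x * cmod c" for x :: "'n fock"
      by (simp add: norm_fock_scaleC)
  qed
qed

text \<open>\<open>h \<otimes> \<xi>\<close> for \<open>h\<close> in the one-particle space and \<open>\<xi>\<close> in the Fock space, in coordinates.\<close>

definition tensor_coord :: "complex ^ 'n \<Rightarrow> ('n list \<Rightarrow> complex) \<Rightarrow> 'n list \<Rightarrow> complex" where
  "tensor_coord h x w = (case w of [] \<Rightarrow> 0 | i # v \<Rightarrow> h $ i * x v)"

lemma L2_set_tensor_coord_le:
  fixes h :: "complex ^ 'n::finite"
  assumes "finite F" and B: "\<And>F. finite F \<Longrightarrow> L2_set (\<lambda>w. cmod (x w)) F \<le> B"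
  shows "L2_set (\<lambda>w. cmod (tensor_coord h x w)) F \<le> norm h * B"
proof -
  define G where "G = (\<lambda>(i, v). i # v) ` (UNIV \<times> tl ` F)"
  have B0: "B \<ge> 0" using B[of "{}"] by simp
  have fG: "finite G" unfolding G_def using assms by auto
  have FG: "F \<subseteq> insert [] G"
  proof
    fix w assume "w \<in> F"
    then show "w \<in> insert [] G" unfolding G_def by (cases w) (auto simp: image_iff, force)
  qed
  have "(\<Sum>w\<in>F. (cmod (tensor_coord h x w))\<^sup>2) \<le> (\<Sum>w\<in>insert [] G. (cmod (tensor_coord h x w))\<^sup>2)"
    by (rule sum_mono2) (use fG FG in auto)
  also have "\<dots> = (\<Sum>w\<in>G. (cmod (tensor_coord h x w))\<^sup>2)"
    using fG by (subst sum.insert) (auto simp: G_def tensor_coord_def)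
  also have "\<dots> = (\<Sum>(i, v)\<in>UNIV \<times> tl ` F. (cmod (h $ i))\<^sup>2 * (cmod (x v))\<^sup>2)"
    unfolding G_def
    by (subst sum.reindex)
       (auto simp: inj_on_def tensor_coord_def norm_mult power_mult_distrib intro!: sum.cong)
  also have "\<dots> = (\<Sum>i\<in>UNIV. (cmod (h $ i))\<^sup>2) * (\<Sum>v\<in>tl ` F. (cmod (x v))\<^sup>2)"
    by (simp add: sum_product sum.cartesian_product)
  also have "\<dots> \<le> (norm h)\<^sup>2 * B\<^sup>2"
  proof (rule mult_mono)
    show "(\<Sum>i\<in>UNIV. (cmod (h $ i))\<^sup>2) \<le> (norm h)\<^sup>2"
      by (simp add: norm_vec_def L2_set_def sum_nonneg)
    show "(\<Sum>v\<in>tl ` F. (cmod (x v))\<^sup>2) \<le> B\<^sup>2"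
      using B[of "tl ` F"] assms(1) unfolding L2_set_def by (intro sqrt_le_D) auto
  qed (auto simp: sum_nonneg)
  finally show ?thesis
    unfolding L2_set_def using B0 by (intro real_le_lsqrt) (auto simp: sum_nonneg power_mult_distrib)
qed

lift_definition fock_tensor :: "complex ^ 'n \<Rightarrow> 'n fock \<Rightarrow> ('n::finite) fock" is tensor_coord
proof -
  fix h :: "complex ^ 'n" and x :: "'n list \<Rightarrow> complex"
  assume "(\<lambda>w. (cmod (x w))\<^sup>2) summable_on UNIV"
  then show "(\<lambda>w. (cmod (tensor_coord h x w))\<^sup>2) summable_on UNIV"
    unfolding sq_summable_iff using L2_set_tensor_coord_le by blast
qed

lemma norm_fock_tensor_le: "norm (fock_tensor h x) \<le> norm h * norm x"
  by (rule norm_fock_leI)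
     (simp add: fock_tensor.rep_eq L2_set_tensor_coord_le L2_set_le_norm_fock)

lift_definition left_creation :: "'n \<Rightarrow> 'n fock \<Rightarrow>\<^sub>L ('n::finite) fock"
  is "\<lambda>i. fock_tensor (axis i 1)"
proof -
  fix i :: 'n
  show "bounded_linear (fock_tensor (axis i 1 :: complex ^ 'n))"
  proof (rule bounded_linear_intro)
    fix x y :: "'n fock" and r :: real
    show "fock_tensor (axis i 1) (x + y) = fock_tensor (axis i 1) x + fock_tensor (axis i 1) y"
      by transfer (auto simp: tensor_coord_def fun_eq_iff algebra_simps split: list.split)
    show "fock_tensor (axis i 1) (r *\<^sub>R x) = r *\<^sub>R fock_tensor (axis i 1) x"
      by transfer (auto simp: tensor_coord_def fun_eq_iff algebra_simps split: list.split)
    show "norm (fock_tensor (axis i 1) x) \<le> norm x * norm (axis i 1 :: complex ^ 'n)"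
      using norm_fock_tensor_le[of "axis i 1" x] by (simp add: mult.commute)
  qed
qed

primrec creation_word :: "'n list \<Rightarrow> 'n fock \<Rightarrow>\<^sub>L ('n::finite) fock" where
  "creation_word [] = id_blinfun"
| "creation_word (i # w) = left_creation i o\<^sub>L creation_word w"


section \<open>Multi-indices and power series on the ball\<close>

type_synonym 'n multiindex = "'n \<Rightarrow> nat"

definition msize :: "'n::finite multiindex \<Rightarrow> nat" where
  "msize p = (\<Sum>i\<in>UNIV. p i)"

definition mfact :: "'n::finite multiindex \<Rightarrow> nat" where
  "mfact p = (\<Prod>i\<in>UNIV. fact (p i))"

definition mmonom :: "complex ^ 'n \<Rightarrow> 'n::finite multiindex \<Rightarrow> complex" where
  "mmonom z p = (\<Prod>i\<in>UNIV. (z $ i) ^ p i)"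

definition word_monom :: "complex ^ 'n \<Rightarrow> 'n::finite list \<Rightarrow> complex" where
  "word_monom z w = prod_list (map (\<lambda>i. z $ i) w)"

definition Lambda_words :: "'n::finite multiindex \<Rightarrow> 'n list set" where
  "Lambda_words p = {w. \<forall>z \<in> ball (0 :: complex ^ 'n) 1. word_monom z w = mmonom z p}"

text \<open>
  The sum over multi-indices is unordered, hence absolute, convergence at every point of the ball;
  the functions having such an expansion are exactly the analytic functions on the ball.
\<close>

definition has_power_series ::
  "('n::finite multiindex \<Rightarrow> complex) \<Rightarrow> (complex ^ 'n \<Rightarrow> complex) \<Rightarrow> bool" where
  "has_power_series a f \<longleftrightarrow> (\<forall>z \<in> ball 0 1. ((\<lambda>p. a p * mmonom z p) has_sum f z) UNIV)"

definition power_coeff :: "(complex ^ 'n \<Rightarrow> complex) \<Rightarrow> 'n::finite multiindex \<Rightarrow> complex" where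
  "power_coeff f = (THE a. has_power_series a f)"

text \<open>
  A function on the ball is represented by its extension by \<open>0\<close>, so that equality of functions
  and the pointwise vector space operations on \<open>complex ^ 'n \<Rightarrow> complex\<close> are those on the ball.
\<close>

definition H_sym :: "(complex ^ 'n::finite \<Rightarrow> complex) set" where
  "H_sym = {f. (\<forall>z. z \<notin> ball 0 1 \<longrightarrow> f z = 0) \<and>
     (\<exists>a. has_power_series a f \<and>
       limsup (\<lambda>k. ereal (root (2 * k)
         (\<Sum>p | msize p = k. real (mfact p) / fact (msize p) * (cmod (a p))\<^sup>2))) \<le> 1)}"

definition f_sym :: "(complex ^ 'n::finite \<Rightarrow> complex) \<Rightarrow> real \<Rightarrow> 'n fock \<Rightarrow>\<^sub>L 'n fock" where
  "f_sym f r = (\<Sum>k. \<Sum>p | msize p = k.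
     fock_scale (of_real (r ^ k) * power_coeff f p * (of_nat (mfact p) / fact (msize p))) o\<^sub>L
       (\<Sum>w\<in>Lambda_words p. creation_word w))"

definition Hinf_sym :: "(complex ^ 'n::finite \<Rightarrow> complex) set" where
  "Hinf_sym = {f \<in> H_sym. bdd_above ((\<lambda>r. norm (f_sym f r)) ` {0..<1})}"

definition norm_sym :: "(complex ^ 'n::finite \<Rightarrow> complex) \<Rightarrow> real" where
  "norm_sym f = (SUP r\<in>{0..<1}. norm (f_sym f r))"


section \<open>Complex Banach spaces on a carrier\<close>

locale complex_banach_space = vector_space scale
  for scale :: "complex \<Rightarrow> 'v::ab_group_add \<Rightarrow> 'v" +
  fixes V :: "'v set" and nrm :: "'v \<Rightarrow> real"
  assumes subspace_carrier: "subspace V"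
    and nrm_nonneg: "x \<in> V \<Longrightarrow> 0 \<le> nrm x"
    and nrm_eq_0_iff: "x \<in> V \<Longrightarrow> nrm x = 0 \<longleftrightarrow> x = 0"
    and nrm_scale: "x \<in> V \<Longrightarrow> nrm (scale c x) = cmod c * nrm x"
    and nrm_triangle: "x \<in> V \<Longrightarrow> y \<in> V \<Longrightarrow> nrm (x + y) \<le> nrm x + nrm y"
    and complete_carrier:
      "(\<forall>k. u k \<in> V) \<Longrightarrow> (\<forall>e>0. \<exists>N. \<forall>j\<ge>N. \<forall>k\<ge>N. nrm (u j - u k) < e) \<Longrightarrow>
        \<exists>x\<in>V. (\<lambda>k. nrm (u k - x)) \<longlonglongrightarrow> 0"

end

theory Submission
  imports Defs "HOL-Combinatorics.Multiset_Permutations"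
    "HOL-Complex_Analysis.Cauchy_Integral_Formula"
begin

text \<open>
  Spread the coefficient \<open>a p\<close> evenly over the words in \<open>Lambda_words p\<close>.  The operators
  \<open>creation_word w\<close> with \<open>length w = k\<close> are isometries with orthogonal ranges, so the homogeneous
  part of degree \<open>k\<close> has as its norm the \<open>l\<^sup>2\<close> norm \<open>level_norm a k\<close> of the coefficients on these words.
  Applying the whole series to the vacuum vector recovers all these coefficients, weighted by
  \<open>r ^ k\<close>, and letting \<open>r\<close> tend to \<open>1\<close> gives \<open>level_norm a k \<le> norm_sym f\<close> for all \<open>k\<close>.
  Hence a Cauchy sequence converges coefficientwise, with all levels converging uniformly in \<open>k\<close>.  For fixed
  \<open>r < 1\<close> this gives convergence of the operators in norm, and the Cauchy estimate, being
  uniform in \<open>r\<close>, passes to the limit.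
\<close>

subsection \<open>Words and multi-indices\<close>

lemma msize_count_list: "msize (count_list w) = length (w :: 'n::finite list)"
  unfolding msize_def by (rule sum_count_set) auto

lemma word_monom_eq_mmonom: "word_monom z w = mmonom z (count_list w)"
proof (induction w)
  case Nil
  then show ?case by (simp add: word_monom_def mmonom_def)
next
  case (Cons j w)
  have "mmonom z (count_list (j # w)) = (\<Prod>i\<in>UNIV. (if j = i then z $ i else 1) * (z $ i) ^ count_list w i)"
    unfolding mmonom_def by (intro prod.cong) auto
  also have "\<dots> = z $ j * mmonom z (count_list w)"
    by (simp add: prod.distrib mmonom_def)
  finally show ?case using Cons by (simp add: word_monom_def del: count_list.simps)
qed

text \<open>On a finite type every multi-index has finite support and thus is a multiset, which
  opens the way to the library's count of permutations.\<close>

lemma count_Abs_multiset_finite: "count (Abs_multiset (p :: 'n::finite \<Rightarrow> nat)) = p"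
  by (rule count_Abs_multiset) auto

lemma Collect_count_list_eq:
  "{w. count_list w = p} = permutations_of_multiset (Abs_multiset (p :: 'n::finite \<Rightarrow> nat))"
  by (auto simp: permutations_of_multiset_def multiset_eq_iff count_Abs_multiset_finite count_mset)

lemma set_mset_Abs_multiset_finite: "set_mset (Abs_multiset p) = {i :: 'n::finite. p i \<noteq> 0}"
  by (auto simp: set_mset_def count_Abs_multiset_finite)

lemma size_Abs_multiset_finite: "size (Abs_multiset p) = msize (p :: 'n::finite \<Rightarrow> nat)"
  unfolding size_multiset_overloaded_eq msize_def
  by (intro sum.mono_neutral_cong_left)
     (auto simp: count_Abs_multiset_finite set_mset_Abs_multiset_finite)

text \<open>The multinomial count of the rearrangements of a multiset, in product form so that no
  division of natural numbers occurs.\<close>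

lemma card_count_list_eq: "card {w. count_list w = p} * mfact p = fact (msize (p :: 'n::finite multiindex))"
proof -
  have "(\<Prod>x\<in>set_mset (Abs_multiset p). fact (count (Abs_multiset p) x)) = mfact p"
    unfolding mfact_def
    by (intro prod.mono_neutral_cong_left)
       (auto simp: count_Abs_multiset_finite set_mset_Abs_multiset_finite)
  then show ?thesis
    using card_permutations_of_multiset_aux[of "Abs_multiset p"]
    by (simp add: Collect_count_list_eq size_Abs_multiset_finite)
qed

lemma mfact_pos: "mfact p > 0"
  unfolding mfact_def by (rule prod_pos) auto

lemma finite_words: "finite {w :: 'n::finite list. length w = k}"
  using finite_lists_length_eq[of "UNIV :: 'n set" k] by simp

lemma finite_msize_eq: "finite {p :: 'n::finite multiindex. msize p = k}"
proof (rule finite_subset)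
  show "{p :: 'n multiindex. msize p = k} \<subseteq> PiE UNIV (\<lambda>_. {..k})"
    unfolding msize_def by (auto intro: member_le_sum)
qed (auto intro: finite_PiE)

text \<open>Each word of length \<open>k\<close> belongs to exactly one multi-index of size
  \<open>k\<close>. This translates between symmetrized sums and sums over words.\<close>

lemma sum_words_by_multiindex:
  "(\<Sum>w | length w = k. g w) = (\<Sum>p | msize p = k. \<Sum>w | count_list w = p. g w)"
  for g :: "'n::finite list \<Rightarrow> 'b::comm_monoid_add"
proof -
  have "(\<Sum>p | msize p = k. \<Sum>w | count_list w = p. g w)
        = (\<Sum>p | msize p = k. sum g {w \<in> {w. length w = k}. count_list w = p})"
    by (intro sum.cong refl) (auto simp: msize_count_list)
  also have "\<dots> = (\<Sum>w | length w = k. g w)"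
    by (rule sum.group) (auto simp: finite_words finite_msize_eq msize_count_list)
  finally show ?thesis by simp
qed

text \<open>Splitting off the first letter pulls out a factor (norm z)^2. The identity supplies the
  second factor when Cauchy-Schwarz is applied to the words of one length.\<close>

lemma sum_words_word_monom:
  "(\<Sum>w | length w = k. (cmod (word_monom z w))\<^sup>2) = (norm (z :: complex ^ 'n::finite)) ^ (2 * k)"
proof (induction k)
  case 0
  then show ?case by (simp add: word_monom_def)
next
  case (Suc k)
  have split: "{w :: 'n list. length w = Suc k} = (\<lambda>(i, w). i # w) ` (UNIV \<times> {w. length w = k})"
    by (auto simp: length_Suc_conv image_iff)
  have "(\<Sum>w | length w = Suc k. (cmod (word_monom z w))\<^sup>2)
      = (\<Sum>(i, w) \<in> UNIV \<times> {w. length w = k}. (cmod (z $ i))\<^sup>2 * (cmod (word_monom z w))\<^sup>2)"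
    by (subst split, subst sum.reindex)
       (auto simp: inj_on_def word_monom_def norm_mult power_mult_distrib intro!: sum.cong)
  also have "\<dots> = (\<Sum>i\<in>UNIV. (cmod (z $ i))\<^sup>2) * (\<Sum>w | length w = k. (cmod (word_monom z w))\<^sup>2)"
    by (simp add: sum_product sum.cartesian_product)
  also have "(\<Sum>i\<in>UNIV. (cmod (z $ i))\<^sup>2) = (norm z)\<^sup>2"
    by (simp add: norm_vec_def L2_set_def sum_nonneg)
  finally show ?case by (simp only: Suc.IH power_add[symmetric]) simp
qed

subsection \<open>Independence of monomials and uniqueness of coefficients\<close>

text \<open>The sum of the coordinate moduli dominates the norm and is at most 1/2 here. This
  provides test points without zero coordinates.\<close>

lemma vec_in_ball_of_bound:
  fixes z :: "complex ^ 'n::finite"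
  assumes "\<And>j. cmod (z $ j) \<le> 1 / (2 * real CARD('n))"
  shows "z \<in> ball 0 1"
proof -
  have "norm z \<le> (\<Sum>j\<in>UNIV. cmod (z $ j))"
    unfolding norm_vec_def by (rule L2_set_le_sum) auto
  also have "\<dots> \<le> (\<Sum>j\<in>(UNIV :: 'n set). 1 / (2 * real CARD('n)))"
    using assms by (intro sum_mono) auto
  also have "\<dots> = 1 / 2" by simp
  finally show ?thesis by simp
qed

lemma power_inject_contraction:
  fixes c :: real
  assumes "0 < c" "c < 1" "c ^ m = c ^ k"
  shows "m = k"
  using assms by (metis linorder_neqE_nat order_less_irrefl power_strict_decreasing)

text \<open>Two test points suffice. At the constant vector \<open>c\<close> the monomial is
  \<open>c ^ msize p\<close>; halving coordinate \<open>i\<close> multiplies it by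
  \<open>(1 / 2) ^ p i\<close>, and the quotient determines \<open>p i\<close>.\<close>

lemma mmonom_inject:
  fixes p q :: "'n::finite multiindex"
  assumes eq: "\<And>z. z \<in> ball 0 1 \<Longrightarrow> mmonom z p = mmonom z q"
  shows "p = q"
proof
  fix i
  define c where "c = 1 / (2 * real CARD('n))"
  have "1 \<le> real CARD('n)"
    using one_le_card_finite[where 'a = 'n] by simp
  then have c: "0 < c" "c < 1"
    unfolding c_def by (simp, subst divide_less_eq_1_pos, linarith+)
  have y: "mmonom (\<chi> j. complex_of_real c) r = complex_of_real (c ^ msize r)" for r :: "'n multiindex"
    by (simp add: mmonom_def msize_def power_sum)
  have "(\<chi> j. complex_of_real c) \<in> ball (0 :: complex ^ 'n) 1"
    by (rule vec_in_ball_of_bound) (simp add: c_def norm_divide norm_mult)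
  from eq[OF this] have sz: "c ^ msize p = c ^ msize q" unfolding y of_real_eq_iff .
  let ?z = "(\<chi> j. complex_of_real (c * (if j = i then 1 / 2 else 1))) :: complex ^ 'n"
  have "mmonom ?z r = (\<Prod>j\<in>UNIV. complex_of_real (c ^ r j) * (if j = i then complex_of_real ((1 / 2) ^ r j) else 1))"
    for r :: "'n multiindex"
    unfolding mmonom_def by (intro prod.cong refl) (simp add: power_mult_distrib power_divide)
  then have z: "mmonom ?z r = complex_of_real (c ^ msize r * (1 / 2) ^ r i)" for r :: "'n multiindex"
    by (simp add: prod.distrib msize_def power_sum)
  have "?z \<in> ball 0 1"
    by (rule vec_in_ball_of_bound) (use c in \<open>auto simp: c_def norm_mult norm_divide field_simps\<close>)
  from eq[OF this] have "c ^ msize p * (1 / 2) ^ p i = c ^ msize q * (1 / 2) ^ q i"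
    unfolding z of_real_eq_iff .
  with sz c have "(1 / 2 :: real) ^ p i = (1 / 2) ^ q i" by simp
  then show "p i = q i" by (intro power_inject_contraction[of "1 / 2"]) auto
qed

lemma Lambda_words_eq: "Lambda_words p = {w. count_list w = p}"
  unfolding Lambda_words_def word_monom_eq_mmonom using mmonom_inject by blast

text \<open>Dedekind's argument for the independence of characters, applied to the characters
  \<open>mmonom _ p\<close> of the multiplicative semigroup of the ball.\<close>

lemma mmonom_independent:
  fixes c :: "'n::finite multiindex \<Rightarrow> complex"
  assumes "finite F" and "\<And>z. z \<in> ball 0 1 \<Longrightarrow> (\<Sum>p\<in>F. c p * mmonom z p) = 0" and "p \<in> F"
  shows "c p = 0"
  using assms
proof (induction F arbitrary: c p rule: finite_induct)
  case empty
  then show ?case by simp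
next
  case (insert q F)
  have ne: "c p' = 0" if "p' \<in> F" for p'
  proof -
    have "p' \<noteq> q" using insert that by auto
    then obtain y :: "complex ^ 'n" where y: "y \<in> ball 0 1" "mmonom y p' \<noteq> mmonom y q"
      using mmonom_inject by blast
    \<comment> \<open>Subtract \<open>mmonom y q\<close> times the relation at \<open>z\<close> from
      the relation at the coordinatewise product of \<open>y\<close> and \<open>z\<close>: the term
      of \<open>q\<close> cancels, and the induction hypothesis applies to \<open>F\<close>.\<close>
    have "(\<Sum>p\<in>F. (c p * (mmonom y p - mmonom y q)) * mmonom z p) = 0" if z: "z \<in> ball 0 1" for z
    proof -
      let ?yz = "\<chi> i. y $ i * z $ i"
      have yz: "mmonom ?yz r = mmonom y r * mmonom z r" for r
        by (simp add: mmonom_def power_mult_distrib prod.distrib)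
      have "norm ?yz \<le> norm z"
        unfolding norm_vec_def
      proof (rule L2_set_mono)
        fix i
        have "cmod (y $ i) \<le> 1" using y(1) Finite_Cartesian_Product.norm_nth_le[of y i] by simp
        then show "cmod (?yz $ i) \<le> cmod (z $ i)"
          by (simp add: norm_mult mult_left_le_one_le)
      qed simp
      then have "?yz \<in> ball 0 1" using z by simp
      from insert.prems(1)[OF this] insert.prems(1)[OF z]
      have "(\<Sum>p\<in>insert q F. c p * mmonom ?yz p) - mmonom y q * (\<Sum>p\<in>insert q F. c p * mmonom z p) = 0"
        by simp
      then have "(\<Sum>p\<in>insert q F. (c p * (mmonom y p - mmonom y q)) * mmonom z p) = 0"
        by (simp only: yz sum_distrib_left sum_subtractf[symmetric]) (simp add: algebra_simps)
      then show ?thesis using insert.hyps by simp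
    qed
    from insert.IH[OF this \<open>p' \<in> F\<close>] y(2) show ?thesis by simp
  qed
  \<comment> \<open>All coordinates of this point are nonzero, so \<open>mmonom z q\<close> does not
    vanish and the one remaining term forces \<open>c q = 0\<close>.\<close>
  define z where "z = (\<chi> j. complex_of_real (1 / (2 * real CARD('n))) :: complex ^ 'n)"
  have "z \<in> ball 0 1" by (rule vec_in_ball_of_bound) (simp add: z_def norm_divide)
  from insert.prems(1)[OF this] have "c q * mmonom z q = 0" using insert.hyps ne by simp
  moreover have "mmonom z q \<noteq> 0" by (simp add: mmonom_def z_def)
  ultimately show ?case using ne insert.prems by auto
qed

text \<open>A nonzero coefficient of positive index would make 0 an isolated zero of the sum, which
  vanishes on the whole disc; the constant term is read off at \<open>t = 0\<close>.\<close>

lemma power_series_coeffs_zero: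
  fixes a :: "nat \<Rightarrow> complex"
  assumes "\<And>t. cmod t < 1 \<Longrightarrow> (\<lambda>k. a k * t ^ k) sums 0"
  shows "a k = 0"
proof (rule ccontr)
  assume k: "a k \<noteq> 0"
  have "a 0 = 0" using assms[of 0] by simp
  with k have "k > 0" by (metis gr0I)
  show False
  proof (rule powser_0_nonzero[where r = 1 and a = a and \<xi> = 0 and f = "\<lambda>_. 0" and m = k])
    fix s :: real
    assume "0 < s" "\<And>z :: complex. z \<in> cball 0 s - {0} \<Longrightarrow> 0 \<noteq> (0 :: complex)"
    from this(2)[of "of_real s"] this(1) show False by simp
  qed (use assms k \<open>k > 0\<close> in auto)
qed

text \<open>Along the points \<open>t *s z\<close> the expansion is a power series in
  \<open>t\<close> whose coefficients are the homogeneous parts at \<open>z\<close>. These vanish,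
  and each is a finite combination of independent monomials.\<close>

lemma has_power_series_zero:
  fixes a :: "'n::finite multiindex \<Rightarrow> complex"
  assumes "has_power_series a f" and f0: "\<And>z. z \<in> ball 0 1 \<Longrightarrow> f z = 0"
  shows "a p = 0"
proof -
  have "(\<Sum>p | msize p = k. a p * mmonom z p) = 0" if z: "z \<in> ball 0 1" for z k
  proof (rule power_series_coeffs_zero[of "\<lambda>k. \<Sum>p | msize p = k. a p * mmonom z p"])
    fix t :: complex assume t: "cmod t < 1"
    have tz: "mmonom (t *s z) p = t ^ msize p * mmonom z p" for p
      by (simp add: mmonom_def msize_def power_mult_distrib prod.distrib power_sum)
    have "norm (t *s z) \<le> norm z"
      unfolding norm_vec_def
      by (rule L2_set_mono) (use t in \<open>auto simp: norm_mult mult_left_le_one_le\<close>)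
    then have "t *s z \<in> ball 0 1" using z by simp
    with assms have "((\<lambda>p. a p * mmonom (t *s z) p) has_sum 0) UNIV"
      unfolding has_power_series_def by force
    \<comment> \<open>The sum is unordered, so it may be regrouped by degree.\<close>
    then have "((\<lambda>(k, p). a p * mmonom (t *s z) p) has_sum 0) (SIGMA k:UNIV. {p. msize p = k})"
      by (subst has_sum_reindex_bij_witness[where j = snd and i = "\<lambda>p. (msize p, p)" and T = UNIV]) auto
    then have "((\<lambda>k. \<Sum>p | msize p = k. a p * mmonom (t *s z) p) has_sum 0) UNIV"
      by (rule has_sum_Sigma') (auto intro!: has_sum_finite simp: finite_msize_eq)
    then have "(\<lambda>k. \<Sum>p | msize p = k. a p * mmonom (t *s z) p) sums 0"
      by (rule has_sum_imp_sums)
    moreover have "(\<Sum>p | msize p = k. a p * mmonom (t *s z) p)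
        = (\<Sum>p | msize p = k. a p * mmonom z p) * t ^ k" for k
      unfolding sum_distrib_right by (intro sum.cong) (auto simp: tz)
    ultimately show "(\<lambda>k. (\<Sum>p | msize p = k. a p * mmonom z p) * t ^ k) sums 0" by simp
  qed
  then show ?thesis
    using mmonom_independent[of "{q. msize q = msize p}" a p] finite_msize_eq by blast
qed

section \<open>Linearity and uniqueness of the coefficients\<close>

lemma has_power_series_add:
  assumes "has_power_series a f" "has_power_series b g"
  shows "has_power_series (\<lambda>p. a p + b p) (f + g)"
  using assms unfolding has_power_series_def by (auto simp: distrib_right intro!: has_sum_add)

lemma has_power_series_cmult:
  assumes "has_power_series a f"
  shows "has_power_series (\<lambda>p. c * a p) (\<lambda>z. c * f z)"
  using assms unfolding has_power_series_def by (auto simp: mult.assoc intro!: has_sum_cmult_right)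

text \<open>Two expansions of \<open>f\<close> differ by an expansion of zero on the ball, so the
  description in \<open>power_coeff\<close> picks out a unique family.\<close>

lemma power_coeff_eq:
  assumes a: "has_power_series a f"
  shows "power_coeff f = a"
  unfolding power_coeff_def
proof (rule the_equality, rule a, rule ext)
  fix b p assume "has_power_series b f"
  from has_power_series_add[OF this has_power_series_cmult[OF a, of "-1"]]
  show "b p = a p" by (auto dest!: has_power_series_zero[where p = p])
qed

subsection \<open>Homogeneous operators\<close>

text \<open>The factor is the reciprocal of the number of words with the same letter counts as
  \<open>w\<close>; see \<open>card_mult_weight\<close>.\<close>

definition wcoef :: "('n::finite multiindex \<Rightarrow> complex) \<Rightarrow> 'n list \<Rightarrow> complex" where
  "wcoef a w = a (count_list w) * (of_nat (mfact (count_list w)) / fact (length w))"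

text \<open>Its square is the weighted sum in the definition of \<open>H_sym\<close>; see
  \<open>level_norm_sq\<close>.\<close>

definition level_norm :: "('n::finite multiindex \<Rightarrow> complex) \<Rightarrow> nat \<Rightarrow> real" where
  "level_norm a k = L2_set (\<lambda>w. cmod (wcoef a w)) {w. length w = k}"

text \<open>The degree \<open>k\<close> term of \<open>f_sym\<close> without the power of
  \<open>r\<close>, kept in the same form so that \<open>f_sym\<close> becomes
  \<open>op_series\<close> by rewriting.\<close>

definition hom_op :: "('n::finite multiindex \<Rightarrow> complex) \<Rightarrow> nat \<Rightarrow> 'n fock \<Rightarrow>\<^sub>L 'n fock" where
  "hom_op a k = (\<Sum>p | msize p = k. fock_scale (a p * (of_nat (mfact p) / fact (msize p))) o\<^sub>L
     (\<Sum>w\<in>Lambda_words p. creation_word w))"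

lemma wcoef_add: "wcoef (\<lambda>p. a p + b p) w = wcoef a w + wcoef b w"
  by (simp add: wcoef_def distrib_right add_divide_distrib)

lemma wcoef_cmult: "wcoef (\<lambda>p. c * a p) w = c * wcoef a w"
  by (simp add: wcoef_def)

lemma level_norm_nonneg: "0 \<le> level_norm a k"
  by (simp add: level_norm_def)

lemma level_norm_add: "level_norm (\<lambda>p. a p + b p) k \<le> level_norm a k + level_norm b k"
  unfolding level_norm_def wcoef_add by (rule L2_set_add_le)

lemma level_norm_cmult: "level_norm (\<lambda>p. c * a p) k = cmod c * level_norm a k"
  unfolding level_norm_def wcoef_cmult by (rule L2_set_cmult)

lemma card_mult_weight:
  fixes p :: "'n::finite multiindex"
  shows "real (card {w. count_list w = p}) * (real (mfact p) / fact (msize p)) = 1"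
proof -
  have "real (card {w. count_list w = p}) * real (mfact p) = fact (msize p)"
    by (metis card_count_list_eq of_nat_fact of_nat_mult)
  then show ?thesis by simp
qed

lemma cmod_wcoef: "count_list w = p \<Longrightarrow> cmod (wcoef a w) = cmod (a p) * (real (mfact p) / fact (msize p))"
  by (auto simp: wcoef_def norm_mult norm_divide msize_count_list)

text \<open>All words of \<open>p\<close> carry the same coefficient \<open>a p\<close> times the
  weight. Of the two weights in its square, one cancels against the number of these words.\<close>

lemma level_norm_sq:
  "(level_norm a k)\<^sup>2 = (\<Sum>p | msize p = k. real (mfact p) / fact (msize p) * (cmod (a p))\<^sup>2)"
proof -
  have "(level_norm a k)\<^sup>2 = (\<Sum>w | length w = k. (cmod (wcoef a w))\<^sup>2)"
    by (simp add: level_norm_def L2_set_def sum_nonneg)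
  also have "\<dots> = (\<Sum>p | msize p = k. \<Sum>w | count_list w = p. (cmod (wcoef a w))\<^sup>2)"
    by (rule sum_words_by_multiindex)
  also have "\<dots> = (\<Sum>p | msize p = k. real (mfact p) / fact (msize p) * (cmod (a p))\<^sup>2)"
  proof (intro sum.cong refl)
    fix p :: "'a multiindex"
    let ?t = "real (mfact p) / fact (msize p)" and ?c = "real (card {w. count_list w = p})"
    have "(\<Sum>w | count_list w = p. (cmod (wcoef a w))\<^sup>2) = (\<Sum>w | count_list w = p. (cmod (a p) * ?t)\<^sup>2)"
      by (intro sum.cong refl) (simp add: cmod_wcoef)
    also have "\<dots> = (?c * ?t) * (?t * (cmod (a p))\<^sup>2)"
      by (simp add: power2_eq_square)
    finally show "(\<Sum>w | count_list w = p. (cmod (wcoef a w))\<^sup>2) = ?t * (cmod (a p))\<^sup>2"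
      unfolding card_mult_weight by simp
  qed
  finally show ?thesis .
qed

lemma hom_op_eq_sum_words:
  "hom_op a k = (\<Sum>w | length w = k. fock_scale (wcoef a w) o\<^sub>L creation_word w)"
  unfolding hom_op_def sum_words_by_multiindex Lambda_words_eq bounded_bilinear.sum_right[OF bounded_bilinear_blinfun_compose]
  by (intro sum.cong refl) (auto simp: wcoef_def msize_count_list)

section \<open>Coordinates and norms of the homogeneous operators\<close>

lemma bounded_linear_fock_coord: "bounded_linear (\<lambda>x. fock_coord x w)"
  by (rule bounded_linear_intro[where K = 1])
     (auto simp: plus_fock.rep_eq scaleR_fock.rep_eq scaleR_conv_of_real cmod_coord_le_norm_fock)

lemma fock_coord_scale: "fock_coord (fock_scale c x) v = c * fock_coord x v"
  by (simp add: fock_scale.rep_eq fock_scaleC.rep_eq)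

text \<open>The operator prepends \<open>w\<close>, so only words with prefix \<open>w\<close> are
  reached. If \<open>v\<close> is shorter than \<open>w\<close>, then
  \<open>take (length w) v\<close> is \<open>v\<close> and the test fails.\<close>

lemma fock_coord_creation_word:
  "fock_coord (creation_word w x) v = (if take (length w) v = w then fock_coord x (drop (length w) v) else 0)"
proof (induction w arbitrary: v)
  case Nil
  then show ?case by simp
next
  case (Cons i w)
  then show ?case
    by (cases v) (auto simp: left_creation.rep_eq fock_tensor.rep_eq tensor_coord_def axis_def)
qed

text \<open>Creation words of equal length have ranges with disjoint supports, so in coordinate
  \<open>v\<close> only the word \<open>take k v\<close> contributes.\<close>

lemma fock_coord_hom_op:
  "fock_coord (hom_op a k x) v =
    (if k \<le> length v then wcoef a (take k v) * fock_coord x (drop k v) else 0)"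
proof -
  have "fock_coord (hom_op a k x) v =
      (\<Sum>w | length w = k. fock_coord ((fock_scale (wcoef a w) o\<^sub>L creation_word w) x) v)"
    unfolding hom_op_eq_sum_words blinfun.sum_left
    by (rule linear_sum[OF bounded_linear.linear[OF bounded_linear_fock_coord]])
  also have "\<dots> = (\<Sum>w | length w = k. if take k v = w then wcoef a w * fock_coord x (drop k v) else 0)"
    by (intro sum.cong) (auto simp: fock_coord_scale fock_coord_creation_word)
  finally show ?thesis by (simp add: sum.delta' finite_words min_def)
qed

text \<open>Cutting a word after \<open>k\<close> letters is injective, and there are no cross
  terms. The sum of squares is thus part of a sum over a product set, which factors.\<close>

lemma norm_hom_op_le: "norm (hom_op a k) \<le> level_norm a k"
proof (rule norm_blinfun_bound[OF level_norm_nonneg], rule norm_fock_leI)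
  fix x :: "'a fock" and F :: "'a list set"
  assume F: "finite F"
  let ?G = "{v \<in> F. k \<le> length v}"
  have "(\<Sum>v\<in>F. (cmod (fock_coord (hom_op a k x) v))\<^sup>2)
      = (\<Sum>v\<in>?G. (cmod (wcoef a (take k v)))\<^sup>2 * (cmod (fock_coord x (drop k v)))\<^sup>2)"
    by (rule sum.mono_neutral_cong_right)
       (use F in \<open>auto simp: fock_coord_hom_op norm_mult power_mult_distrib\<close>)
  also have "\<dots> = (\<Sum>(w, u)\<in>(\<lambda>v. (take k v, drop k v)) ` ?G. (cmod (wcoef a w))\<^sup>2 * (cmod (fock_coord x u))\<^sup>2)"
    by (subst sum.reindex) (auto simp: inj_on_def, metis append_take_drop_id)
  also have "\<dots> \<le> (\<Sum>(w, u)\<in>{w. length w = k} \<times> drop k ` F. (cmod (wcoef a w))\<^sup>2 * (cmod (fock_coord x u))\<^sup>2)"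
    by (rule sum_mono2) (use F in \<open>auto simp: finite_words\<close>)
  also have "\<dots> = (\<Sum>w | length w = k. (cmod (wcoef a w))\<^sup>2) * (\<Sum>u\<in>drop k ` F. (cmod (fock_coord x u))\<^sup>2)"
    by (simp add: sum_product sum.cartesian_product)
  finally have "L2_set (\<lambda>v. cmod (fock_coord (hom_op a k x) v)) F
      \<le> level_norm a k * L2_set (\<lambda>u. cmod (fock_coord x u)) (drop k ` F)"
    unfolding L2_set_def level_norm_def by (simp flip: real_sqrt_mult)
  also have "\<dots> \<le> level_norm a k * norm x"
    by (intro mult_left_mono L2_set_le_norm_fock level_norm_nonneg) (use F in auto)
  finally show "L2_set (\<lambda>v. cmod (fock_coord (hom_op a k x) v)) F \<le> level_norm a k * norm x" .
qed

lemma fock_eqI: "(\<And>w. fock_coord x w = fock_coord y w) \<Longrightarrow> x = y"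
  by (metis fock_coord_inject ext)

lemma hom_op_add: "hom_op (\<lambda>p. a p + b p) k = hom_op a k + hom_op b k"
  by (intro blinfun_eqI fock_eqI)
     (simp add: fock_coord_hom_op plus_fock.rep_eq blinfun.add_left wcoef_add distrib_right)

lemma hom_op_cmult: "hom_op (\<lambda>p. c * a p) k = fock_scale c o\<^sub>L hom_op a k"
  by (intro blinfun_eqI fock_eqI)
     (simp add: fock_coord_hom_op fock_coord_scale wcoef_cmult)

text \<open>Multiplication by \<open>c\<close> scales the norm of every vector by exactly
  \<open>cmod c\<close>; for nonzero \<open>c\<close> this can be divided out, which gives the
  reverse inequality.\<close>

lemma norm_fock_scale_compose: "norm (fock_scale c o\<^sub>L T) = cmod c * norm T"
proof (rule antisym)
  have *: "norm ((fock_scale c o\<^sub>L T) x) = cmod c * norm (T x)" for x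
    by (simp add: fock_scale.rep_eq norm_fock_scaleC)
  show "norm (fock_scale c o\<^sub>L T) \<le> cmod c * norm T"
    by (rule norm_blinfun_bound)
       (auto simp: fock_scale.rep_eq norm_fock_scaleC mult.assoc intro!: mult_left_mono norm_blinfun)
  show "cmod c * norm T \<le> norm (fock_scale c o\<^sub>L T)"
  proof (cases "c = 0")
    case False
    have "norm (T x) \<le> norm (fock_scale c o\<^sub>L T) / cmod c * norm x" for x
      using norm_blinfun[of "fock_scale c o\<^sub>L T" x] False unfolding * by (simp add: field_simps)
    then have "norm T \<le> norm (fock_scale c o\<^sub>L T) / cmod c"
      by (intro norm_blinfun_bound) auto
    then show ?thesis using False by (simp add: field_simps)
  qed simp
qed

subsection \<open>The symmetrized calculus in terms of coefficients\<close>

text \<open>The root condition of \<open>H_sym\<close> in a form without roots: the power series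
  with coefficients \<open>level_norm a k\<close> has radius of convergence at least 1.\<close>

definition subexponential :: "('n::finite multiindex \<Rightarrow> complex) \<Rightarrow> bool" where
  "subexponential a \<longleftrightarrow> (\<forall>r. 0 \<le> r \<and> r < 1 \<longrightarrow> (\<exists>M. \<forall>k. r ^ k * level_norm a k \<le> M))"

definition op_series :: "('n::finite multiindex \<Rightarrow> complex) \<Rightarrow> real \<Rightarrow> 'n fock \<Rightarrow>\<^sub>L 'n fock" where
  "op_series a r = (\<Sum>k. r ^ k *\<^sub>R hom_op a k)"

lemma fock_scale_of_real_mult: "fock_scale (of_real r * c) = r *\<^sub>R fock_scale c"
  by (intro blinfun_eqI fock_eqI) (simp add: fock_coord_scale blinfun.scaleR_left scaleR_fock.rep_eq)

lemma f_sym_eq_op_series: "f_sym f r = op_series (power_coeff f) r"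
  unfolding f_sym_def op_series_def hom_op_def
  by (simp only: mult.assoc fock_scale_of_real_mult bounded_bilinear.scaleR_left[OF bounded_bilinear_blinfun_compose] scaleR_sum_right)

lemma root_level_norm:
  assumes "k > 0"
  shows "root (2 * k) (\<Sum>p | msize p = k. real (mfact p) / fact (msize p) * (cmod (a p))\<^sup>2)
    = root k (level_norm a k)"
proof -
  have "root (2 * k) ((level_norm a k)\<^sup>2) = root k (root 2 ((level_norm a k)\<^sup>2))"
    by (metis mult.commute real_root_mult_exp)
  also have "root 2 ((level_norm a k)\<^sup>2) = level_norm a k"
    by (simp add: real_root_power_cancel level_norm_nonneg)
  finally show ?thesis by (simp add: level_norm_sq)
qed

text \<open>The root test in both directions. A limsup at most 1 makes the roots eventually smaller
  than \<open>1 / r\<close>; conversely a bound at radius \<open>1 / t\<close> keeps their limsup at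
  most \<open>t\<close>, for every \<open>t > 1\<close>.\<close>

lemma limsup_root_le_1_iff:
  "limsup (\<lambda>k. ereal (root (2 * k)
     (\<Sum>p | msize p = k. real (mfact p) / fact (msize p) * (cmod (a p))\<^sup>2))) \<le> 1
   \<longleftrightarrow> subexponential a" (is "limsup ?x \<le> 1 \<longleftrightarrow> _")
proof
  assume L: "limsup ?x \<le> 1"
  show "subexponential a"
    unfolding subexponential_def
  proof (intro allI impI)
    fix r :: real assume r: "0 \<le> r \<and> r < 1"
    show "\<exists>M. \<forall>k. r ^ k * level_norm a k \<le> M"
    proof (cases "r = 0")
      case True
      then have "r ^ k * level_norm a k \<le> level_norm a 0" for k
        using level_norm_nonneg[of a] by (cases k) auto
      then show ?thesis by blast
    next
      case False
      with r have "1 < ereal (1 / r)" by simp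
      then have "\<forall>\<^sub>F k in sequentially. ?x k < ereal (1 / r)"
        using L unfolding Limsup_le_iff by blast
      then obtain K where K: "\<And>k. k \<ge> K \<Longrightarrow> ?x k < ereal (1 / r)"
        unfolding eventually_sequentially by blast
      \<comment> \<open>Starting at \<open>Suc K\<close> also makes \<open>k\<close> positive, as
        the root identities require.\<close>
      have tail: "r ^ k * level_norm a k \<le> 1" if "k \<ge> Suc K" for k
      proof -
        have "root k (level_norm a k) \<le> 1 / r"
          using K[of k] that root_level_norm[of k a] by simp
        then have "root k (level_norm a k) ^ k \<le> (1 / r) ^ k"
          by (rule power_mono) (use that in \<open>simp add: level_norm_nonneg\<close>)
        then have "level_norm a k \<le> (1 / r) ^ k"
          using that by (simp add: real_root_pow_pos2 level_norm_nonneg)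
        then show ?thesis using r False by (simp add: power_divide field_simps)
      qed
      have "r ^ k * level_norm a k \<le> 1 + (\<Sum>j\<le>K. r ^ j * level_norm a j)" for k
      proof (cases "k \<le> K")
        case True
        then have "r ^ k * level_norm a k \<le> (\<Sum>j\<le>K. r ^ j * level_norm a j)"
          by (intro member_le_sum) (use r in \<open>auto simp: level_norm_nonneg\<close>)
        then show ?thesis by simp
      next
        case False
        have "0 \<le> (\<Sum>j\<le>K. r ^ j * level_norm a j)"
          by (intro sum_nonneg) (use r in \<open>auto simp: level_norm_nonneg\<close>)
        then show ?thesis using tail[of k] False by simp
      qed
      then show ?thesis by blast
    qed
  qed
next
  assume S: "subexponential a"
  show "limsup ?x \<le> 1"
    unfolding Limsup_le_iff
  proof (intro allI impI)
    fix y :: ereal assume "1 < y"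
    then obtain s where s: "1 < ereal s" "ereal s < y"
      using ereal_dense2 by blast
    then have s1: "s > 1" by simp
    define t where "t = (1 + s) / 2"
    have t: "1 < t" "t < s" using s1 by (auto simp: t_def)
    obtain M where M: "\<And>k. (1 / t) ^ k * level_norm a k \<le> M"
      using S[unfolded subexponential_def, rule_format, of "1 / t"] t by auto
    \<comment> \<open>The constant \<open>M\<close> may be 0, whereas the \<open>k\<close>-th roots
      of the positive number \<open>M + 1\<close> tend to 1.\<close>
    have M': "(1 / t) ^ k * level_norm a k \<le> M + 1" for k using M[of k] by simp
    have "0 \<le> M" using M[of 0] level_norm_nonneg[of a 0] by simp
    then have "(\<lambda>k. t * root k (M + 1)) \<longlonglongrightarrow> t * 1"
      by (intro tendsto_intros LIMSEQ_root_const) simp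
    then have "\<forall>\<^sub>F k in sequentially. t * root k (M + 1) < s"
      by (rule order_tendstoD) (use t in simp)
    then show "\<forall>\<^sub>F k in sequentially. ?x k < y"
      using eventually_gt_at_top[of 0]
    proof eventually_elim
      case (elim k)
      have "level_norm a k \<le> t ^ k * (M + 1)"
        using M'[of k] t by (simp add: power_divide field_simps)
      then have "root k (level_norm a k) \<le> root k (t ^ k * (M + 1))"
        using elim by (simp add: real_root_le_mono)
      also have "\<dots> = t * root k (M + 1)"
        using elim t by (simp add: real_root_mult real_root_power_cancel)
      also have "\<dots> < s" by (fact elim)
      finally have "?x k < ereal s" unfolding root_level_norm[OF elim(2)] by simp
      then show ?case using s(2) by (rule less_trans)
    qed
  qed
qed

section \<open>Stability of subexponential growth and convergence of the operator series\<close>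

lemma subexponential_bounded:
  assumes "\<And>k. level_norm a k \<le> M"
  shows "subexponential a"
  unfolding subexponential_def
proof (intro allI impI exI)
  fix r :: real and k assume r: "0 \<le> r \<and> r < 1"
  then have "r ^ k * level_norm a k \<le> 1 * level_norm a k"
    by (intro mult_right_mono power_le_one level_norm_nonneg) auto
  then show "r ^ k * level_norm a k \<le> M" using assms[of k] by simp
qed

lemma subexponential_add:
  assumes "subexponential a" "subexponential b"
  shows "subexponential (\<lambda>p. a p + b p)"
  unfolding subexponential_def
proof (intro allI impI)
  fix r :: real assume r: "0 \<le> r \<and> r < 1"
  then obtain M M' where "\<And>k. r ^ k * level_norm a k \<le> M" "\<And>k. r ^ k * level_norm b k \<le> M'"
    using assms unfolding subexponential_def by meson
  moreover have "r ^ k * level_norm (\<lambda>p. a p + b p) k \<le> r ^ k * (level_norm a k + level_norm b k)" for k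
    by (intro mult_left_mono level_norm_add) (use r in auto)
  ultimately have "r ^ k * level_norm (\<lambda>p. a p + b p) k \<le> M + M'" for k
    by (smt (verit) distrib_left)
  then show "\<exists>M. \<forall>k. r ^ k * level_norm (\<lambda>p. a p + b p) k \<le> M" by blast
qed

lemma subexponential_cmult:
  assumes "subexponential a"
  shows "subexponential (\<lambda>p. c * a p)"
  unfolding subexponential_def
proof (intro allI impI)
  fix r :: real assume r: "0 \<le> r \<and> r < 1"
  then obtain M where "\<And>k. r ^ k * level_norm a k \<le> M"
    using assms unfolding subexponential_def by meson
  then have "cmod c * (r ^ k * level_norm a k) \<le> cmod c * M" for k
    by (intro mult_left_mono) auto
  then show "\<exists>M. \<forall>k. r ^ k * level_norm (\<lambda>p. c * a p) k \<le> M"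
    unfolding level_norm_cmult by (metis mult.left_commute)
qed

text \<open>Boundedness at a radius \<open>s\<close> strictly between \<open>r\<close> and 1 gives
  domination by a geometric series of ratio \<open>r / s\<close>.\<close>

lemma summable_level_norm:
  assumes "subexponential a" "0 \<le> r" "r < 1"
  shows "summable (\<lambda>k. r ^ k * level_norm a k)"
proof -
  define s where "s = (1 + r) / 2"
  have s: "r < s" "s < 1" "0 < s" using assms by (auto simp: s_def)
  obtain M where M: "\<And>k. s ^ k * level_norm a k \<le> M"
    using assms(1)[unfolded subexponential_def, rule_format, of s] s by auto
  show ?thesis
  proof (rule summable_comparison_test')
    show "summable (\<lambda>k. M * (r / s) ^ k)"
      using s assms by (intro summable_mult summable_geometric) simp
    fix k
    have "r ^ k * level_norm a k = (s ^ k * level_norm a k) * (r / s) ^ k"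
      using s by (simp add: power_divide)
    also have "\<dots> \<le> M * (r / s) ^ k"
      using M[of k] s assms by (intro mult_right_mono) auto
    finally show "norm (r ^ k * level_norm a k) \<le> M * (r / s) ^ k"
      using assms level_norm_nonneg[of a k] by simp
  qed
qed

lemma summable_op_series_norm:
  assumes "subexponential a" "0 \<le> r" "r < 1"
  shows "summable (\<lambda>k. norm (r ^ k *\<^sub>R hom_op a k))"
proof (rule summable_comparison_test'[OF summable_level_norm[OF assms]])
  fix k
  show "norm (norm (r ^ k *\<^sub>R hom_op a k)) \<le> r ^ k * level_norm a k"
    using assms(2) by (simp add: mult_left_mono norm_hom_op_le)
qed

lemma summable_op_series:
  assumes "subexponential a" "0 \<le> r" "r < 1"
  shows "summable (\<lambda>k. r ^ k *\<^sub>R hom_op a k)"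
  by (rule summable_norm_cancel[OF summable_op_series_norm[OF assms]])

text \<open>Triangle inequality and geometric series. The bound blows up as \<open>r\<close> tends
  to 1, so in \<open>Hinf_sym_complete\<close> it serves only at a fixed radius.\<close>

lemma norm_op_series_le:
  assumes B: "\<And>k. level_norm a k \<le> B" and r: "0 \<le> r" "r < 1"
  shows "norm (op_series a r) \<le> B / (1 - r)"
proof -
  note a = subexponential_bounded[of a, OF B]
  have le: "norm (r ^ k *\<^sub>R hom_op a k) \<le> B * r ^ k" for k
  proof -
    have "r ^ k * norm (hom_op a k) \<le> r ^ k * B"
      by (rule mult_left_mono[OF order_trans[OF norm_hom_op_le B]]) (use r in simp)
    then show ?thesis using r by (simp add: mult.commute)
  qed
  have "norm (op_series a r) \<le> (\<Sum>k. norm (r ^ k *\<^sub>R hom_op a k))"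
    unfolding op_series_def by (rule summable_norm[OF summable_op_series_norm[OF a r]])
  also have "\<dots> \<le> (\<Sum>k. B * r ^ k)"
    by (rule suminf_le[OF le summable_op_series_norm[OF a r]])
       (use r in \<open>intro summable_mult summable_geometric, simp\<close>)
  also have "\<dots> = B / (1 - r)"
    using r by (simp add: suminf_mult summable_geometric suminf_geometric)
  finally show ?thesis .
qed

lemma op_series_add:
  assumes "subexponential a" "subexponential b" "0 \<le> r" "r < 1"
  shows "op_series (\<lambda>p. a p + b p) r = op_series a r + op_series b r"
  unfolding op_series_def hom_op_add scaleR_add_right
  using assms by (intro suminf_add[symmetric] summable_op_series)

lemma op_series_cmult:
  assumes "subexponential a" "0 \<le> r" "r < 1"
  shows "op_series (\<lambda>p. c * a p) r = fock_scale c o\<^sub>L op_series a r"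
  unfolding op_series_def hom_op_cmult
  by (subst bounded_linear.suminf[OF bounded_bilinear.bounded_linear_right[OF bounded_bilinear_blinfun_compose] summable_op_series[OF assms]])
     (simp add: bounded_bilinear.scaleR_right[OF bounded_bilinear_blinfun_compose])

section \<open>Recovering the coefficients from the vacuum vector\<close>

lift_definition vacuum :: "'n fock" is "\<lambda>w. if w = [] then 1 else 0"
  by (rule summable_on_cong_neutral[THEN iffD1, of UNIV "{[]}" _ "\<lambda>_. 1"]) auto

lemma norm_vacuum_le: "norm (vacuum :: 'n fock) \<le> 1"
proof (rule norm_fock_leI)
  fix F :: "'n list set" assume "finite F"
  then show "L2_set (\<lambda>w. cmod (fock_coord vacuum w)) F \<le> 1"
    by (simp add: L2_set_def vacuum.rep_eq if_distrib[of cmod] if_distrib[of "\<lambda>x. x\<^sup>2"] sum.delta' cong: if_cong)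
qed

text \<open>Evaluation at a vector and taking a coordinate are bounded linear, hence pass through
  the series. The vacuum lives on the empty word, so only the term \<open>k = length w\<close>
  survives.\<close>

lemma fock_coord_op_series_vacuum:
  assumes "subexponential a" "0 \<le> r" "r < 1"
  shows "fock_coord (op_series a r vacuum) w = of_real (r ^ length w) * wcoef a w"
proof -
  have "(\<lambda>k. fock_coord ((r ^ k *\<^sub>R hom_op a k) vacuum) w) sums fock_coord (op_series a r vacuum) w"
    unfolding op_series_def
    by (intro bounded_linear.sums[OF bounded_linear_fock_coord]
          bounded_linear.sums[OF blinfun.bounded_linear_left] summable_sums summable_op_series assms)
  moreover have "fock_coord ((r ^ k *\<^sub>R hom_op a k) vacuum) w
      = (if k = length w then of_real (r ^ length w) * wcoef a w else 0)" for k
    by (auto simp: blinfun.scaleR_left scaleR_fock.rep_eq fock_coord_hom_op vacuum.rep_eq)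
  ultimately show ?thesis
    using sums_single[of "length w" "\<lambda>_. of_real (r ^ length w) * wcoef a w"] sums_unique2 by auto
qed

lemma level_norm_le_norm_op_series:
  assumes "subexponential a" "0 \<le> r" "r < 1"
  shows "r ^ k * level_norm a k \<le> norm (op_series a r)"
proof -
  have "r ^ k * level_norm a k = L2_set (\<lambda>w. r ^ k * cmod (wcoef a w)) {w. length w = k}"
    unfolding level_norm_def using assms by (simp add: L2_set_right_distrib)
  also have "\<dots> = L2_set (\<lambda>w. cmod (fock_coord (op_series a r vacuum) w)) {w. length w = k}"
    by (rule L2_set_cong)
       (use assms in \<open>auto simp: fock_coord_op_series_vacuum norm_mult norm_power\<close>)
  also have "\<dots> \<le> norm (op_series a r vacuum)"
    by (rule L2_set_le_norm_fock) (rule finite_words)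
  also have "\<dots> \<le> norm (op_series a r) * norm (vacuum :: 'a fock)" by (rule norm_blinfun)
  also have "\<dots> \<le> norm (op_series a r)" using norm_vacuum_le by (intro mult_left_le) auto
  finally show ?thesis .
qed

text \<open>Let \<open>r\<close> tend to 1 from the left in
  \<open>level_norm_le_norm_op_series\<close>; the factor \<open>r ^ k\<close> disappears.\<close>

lemma level_norm_le:
  assumes a: "subexponential a" and B: "\<And>r. 0 \<le> r \<Longrightarrow> r < 1 \<Longrightarrow> norm (op_series a r) \<le> B"
  shows "level_norm a k \<le> B"
proof (rule tendsto_upperbound)
  show "((\<lambda>r. r ^ k * level_norm a k) \<longlongrightarrow> level_norm a k) (at_left (1 :: real))"
    by (auto intro!: tendsto_eq_intros)
  have "\<forall>\<^sub>F r in at_left (1 :: real). r \<in> {0<..<1}"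
    by (rule eventually_at_left_real) simp
  then show "\<forall>\<^sub>F r in at_left 1. r ^ k * level_norm a k \<le> B"
  proof eventually_elim
    case (elim r)
    then show ?case
      using level_norm_le_norm_op_series[OF a, of r k] B[of r] by simp
  qed
qed simp

text \<open>Cauchy-Schwarz over the words of length \<open>k\<close> bounds the degree
  \<open>k\<close> terms by \<open>M * norm z ^ k\<close>. A coefficient family with bounded levels
  therefore defines a function on the ball.\<close>

lemma summable_on_power_series:
  fixes z :: "complex ^ 'n::finite"
  assumes M: "\<And>k. level_norm a k \<le> M" and z: "norm z < 1"
  shows "(\<lambda>p. a p * mmonom z p) summable_on UNIV"
  unfolding summable_on_iff_abs_summable_on_complex abs_summable_iff_bdd_above
proof (rule bdd_aboveI2)
  fix F :: "'n multiindex set" assume "F \<in> {F. F \<subseteq> UNIV \<and> finite F}"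
  then have F: "finite F" by simp
  have M0: "0 \<le> M" using M[of 0] level_norm_nonneg[of a 0] by simp
  have cmod_term: "cmod (a p * mmonom z p) = (\<Sum>w | count_list w = p. cmod (wcoef a w) * cmod (word_monom z w))" for p
  proof -
    have "(\<Sum>w | count_list w = p. cmod (wcoef a w) * cmod (word_monom z w))
        = (\<Sum>w | count_list w = p. cmod (a p) * (real (mfact p) / fact (msize p)) * cmod (mmonom z p))"
      by (intro sum.cong refl) (simp add: cmod_wcoef word_monom_eq_mmonom)
    also have "\<dots> = (real (card {w. count_list w = p}) * (real (mfact p) / fact (msize p)))
        * (cmod (a p) * cmod (mmonom z p))"
      by simp
    finally show ?thesis unfolding card_mult_weight by (simp add: norm_mult)
  qed
  have level: "(\<Sum>p | msize p = k. cmod (a p * mmonom z p)) \<le> M * norm z ^ k" for k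
  proof -
    have "(\<Sum>p | msize p = k. cmod (a p * mmonom z p))
        = (\<Sum>w | length w = k. \<bar>cmod (wcoef a w)\<bar> * \<bar>cmod (word_monom z w)\<bar>)"
      by (simp add: cmod_term sum_words_by_multiindex)
    also have "\<dots> \<le> level_norm a k * L2_set (\<lambda>w. cmod (word_monom z w)) {w. length w = k}"
      unfolding level_norm_def by (rule L2_set_mult_ineq)
    also have "L2_set (\<lambda>w. cmod (word_monom z w)) {w. length w = k} = norm z ^ k"
      by (simp add: L2_set_def sum_words_word_monom power_mult mult.commute[of 2] real_sqrt_unique)
    finally show ?thesis using mult_right_mono[OF M[of k], of "norm z ^ k"] by simp
  qed
  \<comment> \<open>The highest degree in \<open>F\<close>; inserting 0 makes the maximum meaningful
    for empty \<open>F\<close>.\<close>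
  define K where "K = Max (insert 0 (msize ` F))"
  have "msize p \<le> K" if "p \<in> F" for p using F that by (auto simp: K_def intro: Max_ge)
  then have "F \<subseteq> (\<Union>k\<le>K. {p. msize p = k})" by auto
  then have "(\<Sum>p\<in>F. cmod (a p * mmonom z p)) \<le> (\<Sum>p\<in>(\<Union>k\<le>K. {p. msize p = k}). cmod (a p * mmonom z p))"
    by (intro sum_mono2) (auto simp: finite_msize_eq)
  also have "\<dots> = (\<Sum>k\<le>K. \<Sum>p | msize p = k. cmod (a p * mmonom z p))"
    by (rule sum.UNION_disjoint) (auto simp: finite_msize_eq)
  also have "\<dots> \<le> (\<Sum>k\<le>K. M * norm z ^ k)" by (intro sum_mono level)
  also have "\<dots> \<le> (\<Sum>k. M * norm z ^ k)"
    by (rule sum_le_suminf) (use z M0 in \<open>auto intro!: summable_mult summable_geometric\<close>)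
  finally show "(\<Sum>p\<in>F. cmod (a p * mmonom z p)) \<le> (\<Sum>k. M * norm z ^ k)" .
qed

subsection \<open>The Banach space\<close>

lemma H_sym_iff:
  "f \<in> H_sym \<longleftrightarrow> (\<forall>z. z \<notin> ball 0 1 \<longrightarrow> f z = 0) \<and> has_power_series (power_coeff f) f
     \<and> subexponential (power_coeff f)"
  unfolding H_sym_def mem_Collect_eq limsup_root_le_1_iff by (metis power_coeff_eq)

text \<open>Together with \<open>Hinf_symD\<close> this reduces all later arguments to
  \<open>op_series\<close> and the coefficients.\<close>

lemma Hinf_symI:
  assumes "\<And>z. z \<notin> ball 0 1 \<Longrightarrow> f z = 0" "has_power_series a f" "subexponential a"
    and B: "\<And>r. 0 \<le> r \<Longrightarrow> r < 1 \<Longrightarrow> norm (op_series a r) \<le> B"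
  shows "f \<in> Hinf_sym" "norm_sym f \<le> B"
proof -
  note a = power_coeff_eq[OF assms(2)]
  show "f \<in> Hinf_sym"
    unfolding Hinf_sym_def f_sym_eq_op_series a using assms a
    by (auto simp: H_sym_iff intro!: bdd_aboveI2[where M = B])
  show "norm_sym f \<le> B"
    unfolding norm_sym_def f_sym_eq_op_series a using B by (intro cSUP_least) auto
qed

lemma Hinf_symD:
  assumes "f \<in> Hinf_sym"
  shows "\<And>z. z \<notin> ball 0 1 \<Longrightarrow> f z = 0" "has_power_series (power_coeff f) f"
    "subexponential (power_coeff f)"
    "\<And>r. 0 \<le> r \<Longrightarrow> r < 1 \<Longrightarrow> norm (op_series (power_coeff f) r) \<le> norm_sym f"
    "level_norm (power_coeff f) k \<le> norm_sym f"
proof -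
  have H: "f \<in> H_sym" and bdd: "bdd_above ((\<lambda>r. norm (f_sym f r)) ` {0..<1})"
    using assms by (auto simp: Hinf_sym_def)
  from H show "\<And>z. z \<notin> ball 0 1 \<Longrightarrow> f z = 0" "has_power_series (power_coeff f) f"
    and sub: "subexponential (power_coeff f)" by (auto simp: H_sym_iff)
  show le: "norm (op_series (power_coeff f) r) \<le> norm_sym f" if "0 \<le> r" "r < 1" for r
    unfolding norm_sym_def using cSUP_upper[OF _ bdd, of r] that by (simp add: f_sym_eq_op_series)
  show "level_norm (power_coeff f) k \<le> norm_sym f"
    by (rule level_norm_le[OF sub le])
qed

section \<open>Vector space operations and norm axioms\<close>

lemma Hinf_sym_add:
  assumes f: "f \<in> Hinf_sym" and g: "g \<in> Hinf_sym"
  shows "f + g \<in> Hinf_sym" "norm_sym (f + g) \<le> norm_sym f + norm_sym g"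
    "power_coeff (f + g) = (\<lambda>p. power_coeff f p + power_coeff g p)"
proof -
  note F = Hinf_symD[OF f] and G = Hinf_symD[OF g]
  note ps = has_power_series_add[OF F(2) G(2)]
  note sub = subexponential_add[OF F(3) G(3)]
  have "norm (op_series (\<lambda>p. power_coeff f p + power_coeff g p) r) \<le> norm_sym f + norm_sym g"
    if "0 \<le> r" "r < 1" for r
    using norm_triangle_le[OF add_mono[OF F(4) G(4)]] that by (simp add: op_series_add F(3) G(3))
  from Hinf_symI[OF _ ps sub this] F(1) G(1)
  show "f + g \<in> Hinf_sym" "norm_sym (f + g) \<le> norm_sym f + norm_sym g" by auto
  show "power_coeff (f + g) = (\<lambda>p. power_coeff f p + power_coeff g p)"
    by (rule power_coeff_eq[OF ps])
qed

lemma Hinf_sym_cmult: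
  assumes f: "f \<in> Hinf_sym"
  shows "(\<lambda>z. c * f z) \<in> Hinf_sym" "norm_sym (\<lambda>z. c * f z) \<le> cmod c * norm_sym f"
    "power_coeff (\<lambda>z. c * f z) = (\<lambda>p. c * power_coeff f p)"
proof -
  note F = Hinf_symD[OF f]
  note ps = has_power_series_cmult[OF F(2), of c]
  note sub = subexponential_cmult[OF F(3), of c]
  have "norm (op_series (\<lambda>p. c * power_coeff f p) r) \<le> cmod c * norm_sym f"
    if "0 \<le> r" "r < 1" for r
    using F(4) that by (simp add: op_series_cmult F(3) norm_fock_scale_compose mult_left_mono)
  from Hinf_symI[OF _ ps sub this] F(1)
  show "(\<lambda>z. c * f z) \<in> Hinf_sym" "norm_sym (\<lambda>z. c * f z) \<le> cmod c * norm_sym f" by auto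
  show "power_coeff (\<lambda>z. c * f z) = (\<lambda>p. c * power_coeff f p)"
    by (rule power_coeff_eq[OF ps])
qed

lemma Hinf_sym_diff:
  assumes f: "f \<in> Hinf_sym" and g: "g \<in> Hinf_sym"
  shows "f - g \<in> Hinf_sym" "power_coeff (f - g) = (\<lambda>p. power_coeff f p - power_coeff g p)"
proof -
  have eq: "f - g = f + (\<lambda>z. (-1) * g z)" by (simp add: fun_eq_iff)
  show "f - g \<in> Hinf_sym"
    unfolding eq by (rule Hinf_sym_add(1)[OF f Hinf_sym_cmult(1)[OF g]])
  show "power_coeff (f - g) = (\<lambda>p. power_coeff f p - power_coeff g p)"
    unfolding eq Hinf_sym_add(3)[OF f Hinf_sym_cmult(1)[OF g]] Hinf_sym_cmult(3)[OF g] by simp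
qed

lemma norm_sym_nonneg: "f \<in> Hinf_sym \<Longrightarrow> 0 \<le> norm_sym f"
  using Hinf_symD(5)[of f 0] level_norm_nonneg[of "power_coeff f" 0] by linarith

lemma norm_sym_cmult:
  assumes f: "f \<in> Hinf_sym"
  shows "norm_sym (\<lambda>z. c * f z) = cmod c * norm_sym f"
proof (rule antisym[OF Hinf_sym_cmult(2)[OF f]])
  show "cmod c * norm_sym f \<le> norm_sym (\<lambda>z. c * f z)"
  proof (cases "c = 0")
    case True
    then show ?thesis using norm_sym_nonneg[OF Hinf_sym_cmult(1)[OF f, of c]] by simp
  next
    case False
    \<comment> \<open>The upper bound, applied to the scalar \<open>1 / c\<close>, yields the lower
      one.\<close>
    have "norm_sym (\<lambda>z. (1 / c) * (c * f z)) \<le> cmod (1 / c) * norm_sym (\<lambda>z. c * f z)"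
      by (rule Hinf_sym_cmult(2)[OF Hinf_sym_cmult(1)[OF f]])
    then show ?thesis using False by (simp add: norm_divide field_simps)
  qed
qed

text \<open>Some word has letter counts \<open>p\<close>, and its coefficient is one entry of the
  level. Control of the norm thus gives control of every coefficient.\<close>

lemma cmod_coeff_le_level_norm:
  "cmod (a p) * (real (mfact p) / fact (msize p)) \<le> level_norm a (msize p)"
proof -
  have "{w. count_list w = p} \<noteq> {}"
    using card_mult_weight[of p] by (metis card.empty mult_zero_left of_nat_0 zero_neq_one)
  then obtain w where w: "count_list w = p" by auto
  have "cmod (wcoef a w) \<le> level_norm a (msize p)"
    unfolding level_norm_def
    by (rule member_le_L2_set) (use w in \<open>auto simp: finite_words msize_count_list\<close>)
  then show ?thesis by (simp add: cmod_wcoef[OF w])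
qed

lemma norm_sym_eq_0_iff:
  assumes f: "f \<in> Hinf_sym"
  shows "norm_sym f = 0 \<longleftrightarrow> f = 0"
proof
  assume 0: "norm_sym f = 0"
  have "power_coeff f p = 0" for p
  proof -
    have t: "0 < real (mfact p) / fact (msize p)" using mfact_pos[of p] by simp
    have "cmod (power_coeff f p) * (real (mfact p) / fact (msize p)) \<le> 0"
      using cmod_coeff_le_level_norm[of "power_coeff f" p] Hinf_symD(5)[OF f, of "msize p"] 0
      by linarith
    then show ?thesis using t by (metis mult_pos_pos not_le zero_less_norm_iff)
  qed
  then have "((\<lambda>_. 0) has_sum f z) (UNIV :: 'a multiindex set)" if "z \<in> ball 0 1" for z
    using Hinf_symD(2)[OF f] that unfolding has_power_series_def by force
  then have "f z = 0" if "z \<in> ball 0 1" for z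
    using that has_sum_unique[OF has_sum_0[of UNIV "\<lambda>_. 0 :: complex"]] by metis
  then show "f = 0" using Hinf_symD(1)[OF f] by (metis ext zero_fun_apply)
next
  assume "f = 0"
  then show "norm_sym f = 0" using norm_sym_cmult[OF f, of 0] by (simp add: zero_fun_def)
qed

lemma zero_in_Hinf_sym: "0 \<in> Hinf_sym"
proof (rule Hinf_symI(1))
  have 0: "level_norm (\<lambda>_ :: 'a multiindex. 0) k \<le> 0" for k
    by (simp add: level_norm_def wcoef_def L2_set_def)
  show "has_power_series (\<lambda>_. 0) (0 :: complex ^ 'a \<Rightarrow> complex)"
    by (simp add: has_power_series_def)
  show "subexponential (\<lambda>_ :: 'a multiindex. 0)" by (rule subexponential_bounded[OF 0])
  show "norm (op_series (\<lambda>_ :: 'a multiindex. 0) r) \<le> 0" if "0 \<le> r" "r < 1" for r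
    using norm_op_series_le[OF 0 that] by simp
qed simp

section \<open>Completeness\<close>

lemma level_norm_tendsto:
  assumes "\<And>p. (\<lambda>k. a k p) \<longlonglongrightarrow> l p"
  shows "(\<lambda>k. level_norm (a k) m) \<longlonglongrightarrow> level_norm l m"
  unfolding level_norm_def L2_set_def wcoef_def by (intro tendsto_intros assms) auto

lemma Hinf_sym_complete:
  fixes u :: "nat \<Rightarrow> complex ^ 'n::finite \<Rightarrow> complex"
  assumes u: "\<And>k. u k \<in> Hinf_sym"
    and C: "\<And>e. e > 0 \<Longrightarrow> \<exists>N. \<forall>j\<ge>N. \<forall>k\<ge>N. norm_sym (u j - u k) < e"
  obtains f where "f \<in> Hinf_sym" "(\<lambda>k. norm_sym (u k - f)) \<longlonglongrightarrow> 0"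
proof -
  define a where "a k = power_coeff (u k)" for k
  note diff = Hinf_sym_diff[OF u u, folded a_def]
  have lev: "level_norm (\<lambda>p. a j p - a k p) m \<le> norm_sym (u j - u k)" for j k m
    using Hinf_symD(5)[OF diff(1), of j k m] unfolding diff(2) .
  have "Cauchy (\<lambda>k. a k p)" for p
  proof (rule metric_CauchyI)
    fix e :: real assume e: "e > 0"
    define t where "t = real (mfact p) / fact (msize p)"
    have t: "t > 0" using mfact_pos[of p] by (simp add: t_def)
    obtain N where N: "\<And>j k. j \<ge> N \<Longrightarrow> k \<ge> N \<Longrightarrow> norm_sym (u j - u k) < e * t"
      using C[of "e * t"] e t by auto
    have "dist (a j p) (a k p) < e" if "j \<ge> N" "k \<ge> N" for j k
    proof -
      have "dist (a j p) (a k p) * t < e * t"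
        using cmod_coeff_le_level_norm[of "\<lambda>p. a j p - a k p" p] lev[of j k "msize p"] N[OF that]
        by (simp add: dist_norm t_def)
      then show ?thesis using t by simp
    qed
    then show "\<exists>N. \<forall>j\<ge>N. \<forall>k\<ge>N. dist (a j p) (a k p) < e" by blast
  qed
  then have "\<forall>p. \<exists>l. (\<lambda>k. a k p) \<longlonglongrightarrow> l"
    by (simp add: Cauchy_convergent_iff convergent_def)
  then obtain l where l: "\<And>p. (\<lambda>k. a k p) \<longlonglongrightarrow> l p" by metis
  \<comment> \<open>Let \<open>k\<close> tend to infinity in \<open>lev\<close>. A level involves
    finitely many coefficients, so their separate limits suffice, and the same \<open>N\<close>
    serves all degrees \<open>m\<close>.\<close>
  have lev_l: "level_norm (\<lambda>p. a j p - l p) m \<le> e"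
    if N: "\<And>j k. j \<ge> N \<Longrightarrow> k \<ge> N \<Longrightarrow> norm_sym (u j - u k) < e" and j: "j \<ge> N" for j m N e
  proof (rule LIMSEQ_le_const2)
    show "(\<lambda>k. level_norm (\<lambda>p. a j p - a k p) m) \<longlonglongrightarrow> level_norm (\<lambda>p. a j p - l p) m"
      by (intro level_norm_tendsto tendsto_intros l)
    show "\<exists>K. \<forall>k\<ge>K. level_norm (\<lambda>p. a j p - a k p) m \<le> e"
      using lev N[OF j] by (meson less_imp_le order_trans)
  qed
  \<comment> \<open>Tolerance 1 at one index is enough to bound all levels of \<open>l\<close>, and
    hence to define the limit function.\<close>
  obtain N1 where N1: "\<And>j k. j \<ge> N1 \<Longrightarrow> k \<ge> N1 \<Longrightarrow> norm_sym (u j - u k) < 1"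
    using C[of 1] by auto
  have l_bound: "level_norm l m \<le> norm_sym (u N1) + 1" for m
  proof -
    have 1: "level_norm (\<lambda>p. a N1 p - l p) m \<le> 1" by (rule lev_l[OF N1 order_refl])
    have "level_norm l m = level_norm (\<lambda>p. a N1 p + (-1) * (a N1 p - l p)) m" by simp
    also have "\<dots> \<le> level_norm (a N1) m + level_norm (\<lambda>p. (-1) * (a N1 p - l p)) m"
      by (rule level_norm_add)
    also have "\<dots> \<le> norm_sym (u N1) + 1"
      unfolding level_norm_cmult
      using 1 Hinf_symD(5)[OF u, of N1 m] by (simp add: a_def)
    finally show ?thesis .
  qed
  define f where "f z = (if z \<in> ball 0 1 then \<Sum>\<^sub>\<infinity>p. l p * mmonom z p else 0)" for z
  have f: "has_power_series l f"
    unfolding has_power_series_def f_def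
    using summable_on_power_series[OF l_bound] by (auto simp: has_sum_infsum)
  have sub: "subexponential (\<lambda>p. a j p - l p)" for j
    using subexponential_add[OF Hinf_symD(3)[OF u, of j]
        subexponential_cmult[OF subexponential_bounded[OF l_bound], of "-1"]]
    by (simp add: a_def)
  have ps: "has_power_series (\<lambda>p. a j p - l p) (u j - f)" for j
  proof -
    have eq: "u j - f = u j + (\<lambda>z. (-1) * f z)" by (simp add: fun_eq_iff)
    show ?thesis
      unfolding eq
      using has_power_series_add[OF Hinf_symD(2)[OF u, of j] has_power_series_cmult[OF f, of "-1"]]
      by (simp add: a_def)
  qed
  \<comment> \<open>Insert an intermediate \<open>a k\<close>. The Cauchy estimate bounds the first
    difference by \<open>e\<close> for every \<open>r\<close>, while \<open>k\<close> may depend on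
    \<open>r\<close> and makes the second at most \<open>d\<close>.\<close>
  have op: "norm (op_series (\<lambda>p. a j p - l p) r) \<le> e"
    if N: "\<And>j k. j \<ge> N \<Longrightarrow> k \<ge> N \<Longrightarrow> norm_sym (u j - u k) < e" and j: "j \<ge> N"
      and r: "0 \<le> r" "r < 1" for j N e r
  proof (rule field_le_epsilon)
    fix d :: real assume "d > 0"
    then have d: "d * (1 - r) > 0" using r by simp
    \<comment> \<open>The factor \<open>1 - r\<close> compensates the denominator in
      \<open>norm_op_series_le\<close>.\<close>
    obtain K where K: "\<And>j k. j \<ge> K \<Longrightarrow> k \<ge> K \<Longrightarrow> norm_sym (u j - u k) < d * (1 - r)"
      using C[OF d] by auto
    define k where "k = max N K"
    have "norm (op_series (\<lambda>p. a k p - l p) r) \<le> d * (1 - r) / (1 - r)"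
      by (rule norm_op_series_le[OF lev_l[OF K] r]) (auto simp: k_def)
    then have 1: "norm (op_series (\<lambda>p. a k p - l p) r) \<le> d" using r by simp
    have 2: "norm (op_series (\<lambda>p. a j p - a k p) r) \<le> e"
      using Hinf_symD(4)[OF diff(1) r, of j k] N[OF j, of k] unfolding diff(2) by (simp add: k_def)
    have "op_series (\<lambda>p. a j p - l p) r = op_series (\<lambda>p. (a j p - a k p) + (a k p - l p)) r"
      by simp
    also have "\<dots> = op_series (\<lambda>p. a j p - a k p) r + op_series (\<lambda>p. a k p - l p) r"
      using Hinf_symD(3)[OF diff(1), of j k] unfolding diff(2) by (intro op_series_add sub r)
    finally show "norm (op_series (\<lambda>p. a j p - l p) r) \<le> e + d"
      using norm_triangle_le[OF add_mono[OF 2 1]] by simp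
  qed
  have out: "(u j - f) z = 0" if "z \<notin> ball 0 1" for j z
    using Hinf_symD(1)[OF u that] that by (simp add: f_def)
  \<comment> \<open>By \<open>op\<close> the operators of this difference are bounded by 1;
    subtracting it from \<open>u N1\<close> then places \<open>f\<close> itself in the
    space.\<close>
  have "u N1 - f \<in> Hinf_sym"
    by (rule Hinf_symI(1)[OF out ps sub op[OF N1]]) auto
  from Hinf_sym_diff(1)[OF u[of N1] this] have fH: "f \<in> Hinf_sym" by simp
  have "(\<lambda>k. norm_sym (u k - f)) \<longlonglongrightarrow> 0"
  proof (rule LIMSEQ_I)
    fix e :: real assume e: "e > 0"
    then obtain N where N: "\<And>j k. j \<ge> N \<Longrightarrow> k \<ge> N \<Longrightarrow> norm_sym (u j - u k) < e / 2"
      using C[of "e / 2"] by auto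
    have "norm_sym (u j - f) \<le> e / 2" if "j \<ge> N" for j
      by (rule Hinf_symI(2)[OF out ps sub op[OF N that]])
    moreover have "0 \<le> norm_sym (u j - f)" for j
      by (rule norm_sym_nonneg[OF Hinf_sym_diff(1)[OF u fH]])
    ultimately show "\<exists>N. \<forall>j\<ge>N. norm (norm_sym (u j - f) - 0) < e"
      using e by (intro exI[of _ N]) (force simp: abs_of_nonneg)
  qed
  with fH that show thesis by blast
qed

theorem theorem7p4:
  shows "complex_banach_space (\<lambda>c f z. c * f z)
           (Hinf_sym :: (complex ^ 'n::finite \<Rightarrow> complex) set) norm_sym"
proof -
  \<comment> \<open>The interpretation on all functions supplies the vector space axioms and the
    notion \<open>subspace\<close> for the carrier.\<close>
  interpret vector_space "\<lambda>c (f :: complex ^ 'n \<Rightarrow> complex) z. c * f z"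
    by unfold_locales (auto simp: fun_eq_iff algebra_simps)
  show ?thesis
  proof unfold_locales
    show "subspace (Hinf_sym :: (complex ^ 'n \<Rightarrow> complex) set)"
      by (rule subspaceI) (auto intro: zero_in_Hinf_sym Hinf_sym_add(1) Hinf_sym_cmult(1))
    fix u :: "nat \<Rightarrow> complex ^ 'n \<Rightarrow> complex"
    assume "\<forall>k. u k \<in> Hinf_sym" "\<forall>e>0. \<exists>N. \<forall>j\<ge>N. \<forall>k\<ge>N. norm_sym (u j - u k) < e"
    then show "\<exists>f\<in>Hinf_sym. (\<lambda>k. norm_sym (u k - f)) \<longlonglongrightarrow> 0"
      using Hinf_sym_complete[of u] by metis
  qed (auto simp: norm_sym_nonneg norm_sym_eq_0_iff norm_sym_cmult Hinf_sym_add(2))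
qed

end
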